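(* Let $X\in\mathbb{R}^{p\times n}$ have rank $p$, where $p\le n$. Let $$P = \operatorname*{arg\,min}_{\tilde{P} \in \mathcal{S}_{p}^F} \operatorname{tr}(\tilde{P}^{-1}XX^T).$$ Set $\ell = \|P^{-1}X\|$ and $W = P^{-1}X/\ell$. Then $$X = \ell P W$$ is the polar decomposition of $X$.
   Context: All matrices are real. $\mathcal{S}_{p}^F$ denotes the space of $p\times p$ (symmetric) positive definite matrices with unit trace. $\|\cdot\|$ is the Frobenius norm. The (left) polar decomposition of a rank-$p$ matrix $X\in\mathbb{R}^{p\times n}$ ($p\le n$) is the unique factorization of $X$ as the product of a $p \times p$ symmetric positive definite matrix and a $p\times n$ matrix with orthonormal rows. In the form $X = \ell P W$, the scalar $\ell > 0$ is separated from the positive definite factor, so that $P$ has unit trace.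
   Formalization: With the Frobenius norm, W has norm 1, so for p ≥ 2 its rows are not orthonormal (X = I_2 gives WW^T = I/2); proved instead: X = ℓPW, and the unique polar factors are (ℓ/√p)P and √p W, which agrees with the original claim when p = 1. *)

theory Defs
  imports "HOL-Analysis.Analysis"
begin

text \<open>A matrix with \<open>p\<close> rows and \<open>n\<close> columns has type \<open>real ^ 'n ^ 'p\<close>; the library norm on
  this type is the square root of the sum of the squared entries, i.e. the Frobenius norm.\<close>

definition pos_def :: "real ^ 'p ^ 'p \<Rightarrow> bool" where
  "pos_def A \<longleftrightarrow> transpose A = A \<and> (\<forall>x. x \<noteq> 0 \<longrightarrow> 0 < x \<bullet> (A *v x))"

definition unit_trace_pd :: "(real ^ 'p ^ 'p) set" where
  "unit_trace_pd = {A. pos_def A \<and> trace A = 1}"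

definition orthonormal_rows :: "real ^ 'n ^ 'p \<Rightarrow> bool" where
  "orthonormal_rows Q \<longleftrightarrow> (\<forall>i j. row i Q \<bullet> row j Q = (if i = j then 1 else 0))"

text \<open>Orthonormal rows force \<open>norm Q = sqrt p\<close>. Hence a factorization \<open>X = l P W\<close> with
  \<open>norm W = 1\<close> corresponds to the polar factors \<open>S = (l / sqrt p) P\<close> and \<open>Q = (sqrt p) W\<close>.\<close>

definition left_polar :: "real ^ 'n ^ 'p \<Rightarrow> real ^ 'p ^ 'p \<Rightarrow> real ^ 'n ^ 'p \<Rightarrow> bool" where
  "left_polar X S Q \<longleftrightarrow> pos_def S \<and> orthonormal_rows Q \<and> X = S ** Q"

end

theory Submission imports Defs begin

text \<open>
  Let \<open>M = X X\<^sup>T\<close>. It is positive definite because \<open>X\<close> has full row rank, so \<open>M = R\<^sup>2\<close> for some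
  positive definite \<open>R\<close> (\<open>pos_def_square_root\<close>, from an orthonormal eigenbasis). Write \<open>t\<close> for
  the trace of \<open>R\<close>. For positive definite \<open>A\<close> of unit trace, completing the square gives
  \<open>tr (A\<^sup>-\<^sup>1 R\<^sup>2) - t\<^sup>2 = tr ((R - t A) A\<^sup>-\<^sup>1 (R - t A))\<close>.
  The right-hand side is nonnegative and vanishes only if \<open>R = t A\<close>, so \<open>R / t\<close> is the unique
  minimizer \<open>P\<close> and the minimum is \<open>t\<^sup>2\<close> (\<open>trace_inverse_square_ge\<close>, \<open>is_arg_min_trace_iff\<close>).

  The minimization problem sees only \<open>R\<^sup>2\<close>, while its minimizer and minimum together determine
  \<open>R\<close>; hence the positive definite square root of a matrix is unique
  (\<open>pos_def_square_root_unique\<close>).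

  The positive definite factor of any left polar decomposition of \<open>X\<close> is a square root of \<open>M\<close>,
  hence equals \<open>R = t P\<close>, and the other factor is then \<open>Q = R\<^sup>-\<^sup>1 X\<close>, whose rows are orthonormal
  since \<open>R\<^sup>-\<^sup>1 M R\<^sup>-\<^sup>1\<close> is the identity. Finally \<open>P\<^sup>-\<^sup>1 X = t Q\<close> has norm \<open>l = t sqrt p\<close>, which
  gives \<open>(l / sqrt p) P = R\<close> and \<open>(sqrt p) W = Q\<close>.
\<close>

section \<open>Eigenbases and square roots\<close>

text \<open>Let \<open>x\<close> maximize the Rayleigh quotient \<open>x \<bullet> f x\<close> over the unit sphere of \<open>V\<close>, with maximum
  \<open>c\<close>. Then \<open>g = c - f\<close> is a positive semidefinite form on \<open>V\<close> that vanishes at \<open>x\<close>. Moving from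
  \<open>x\<close> in the direction \<open>g x\<close> changes the form at first order by twice the squared norm of \<open>g x\<close>,
  so nonnegativity forces \<open>g x = 0\<close>.\<close>

lemma self_adjoint_eigenvector:
  fixes f :: "'a::euclidean_space \<Rightarrow> 'a"
  assumes f: "linear f" and sa: "\<And>x y. f x \<bullet> y = x \<bullet> f y"
    and V: "subspace V" "f ` V \<subseteq> V" "V \<noteq> {0}"
  obtains x c where "x \<in> V" "norm x = 1" "f x = c *\<^sub>R x"
proof -
  let ?K = "V \<inter> sphere 0 1"
  obtain v where v: "v \<in> V" "v \<noteq> 0"
    using V subspace_0[OF V(1)] by auto
  have "(1 / norm v) *\<^sub>R v \<in> ?K"
    using v V(1) by (simp add: subspace_scale)
  moreover have "compact ?K"
    using closed_subspace[OF V(1)] by (simp add: closed_Int_compact)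
  moreover have "continuous_on ?K (\<lambda>x. x \<bullet> f x)"
    using f by (intro continuous_intros linear_continuous_on linear_linear[THEN iffD2])
  ultimately obtain x where x: "x \<in> ?K" and max: "\<And>y. y \<in> ?K \<Longrightarrow> y \<bullet> f y \<le> x \<bullet> f x"
    using continuous_attains_sup[of ?K "\<lambda>x. x \<bullet> f x"] by blast
  define c where "c = x \<bullet> f x"
  define g where "g y = c *\<^sub>R y - f y" for y
  have xx: "x \<bullet> x = 1" using x by (simp add: norm_eq_1)
  have g_sa: "g u \<bullet> w = u \<bullet> g w" for u w
    by (simp add: g_def inner_diff sa)
  have g_add: "g (u + t *\<^sub>R w) = g u + t *\<^sub>R g w" for u w t
    by (simp add: g_def linear_add[OF f] linear_cmul[OF f] algebra_simps)
  have gV: "g y \<in> V" if "y \<in> V" for y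
    using that V by (auto simp: g_def intro!: subspace_diff subspace_scale)
  have g_nonneg: "0 \<le> y \<bullet> g y" if "y \<in> V" for y
  proof (cases "y = 0")
    case False
    have "(1 / norm y) *\<^sub>R y \<in> ?K"
      using that False V(1) by (simp add: subspace_scale)
    from max[OF this] have "(y \<bullet> f y) / (norm y)\<^sup>2 \<le> c"
      by (simp add: c_def linear_cmul[OF f] power2_eq_square)
    then show ?thesis
      using False by (simp add: g_def inner_diff divide_le_eq power2_norm_eq_inner mult.commute)
  qed (simp add: g_def)
  have gx: "x \<bullet> g x = 0"
    by (simp add: g_def inner_diff xx c_def)
  have "g x = 0"
  proof (rule ccontr)
    assume nz: "g x \<noteq> 0"
    define n where "n = g x \<bullet> g x"
    define q where "q = g x \<bullet> g (g x)"
    have n: "0 < n" using nz by (simp add: n_def)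
    have q: "0 \<le> q" unfolding q_def using x by (intro g_nonneg gV) auto
    have *: "0 \<le> 2 * t * n + t\<^sup>2 * q" for t
    proof -
      have "0 \<le> (x + t *\<^sub>R g x) \<bullet> g (x + t *\<^sub>R g x)"
        using x V(1) by (intro g_nonneg) (auto intro!: subspace_add subspace_scale gV)
      also have "\<dots> = 2 * t * n + t\<^sup>2 * q"
        using gx g_sa[of x "g x"] unfolding g_add
        by (simp add: inner_add n_def q_def power2_eq_square inner_commute algebra_simps)
      finally show ?thesis .
    qed
    \<comment> \<open>The minimizer \<open>- n / q\<close> of the parabola would do, but \<open>q\<close> may be zero.\<close>
    define t where "t = - n / (q + 1)"
    have t: "t < 0" using n q by (simp add: t_def)
    have "t * q = - n - t" using q by (simp add: t_def field_simps)
    then have "2 * t * n + t\<^sup>2 * q = t * (n - t)"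
      by (simp add: power2_eq_square mult.assoc) (simp add: algebra_simps)
    also have "\<dots> < 0" using n t by (simp add: mult_neg_pos)
    finally show False using *[of t] by simp
  qed
  then show thesis using that[of x c] x by (simp add: g_def)
qed

text \<open>Split off one unit eigenvector \<open>x\<close>: by self-adjointness its orthogonal complement in \<open>V\<close> is
  again invariant and has smaller dimension.\<close>

lemma self_adjoint_eigenbasis:
  fixes f :: "'a::euclidean_space \<Rightarrow> 'a"
  assumes f: "linear f" and sa: "\<And>x y. f x \<bullet> y = x \<bullet> f y"
    and "subspace V" "f ` V \<subseteq> V"
  shows "\<exists>B. pairwise orthogonal B \<and> (\<forall>b\<in>B. norm b = 1 \<and> (\<exists>c. f b = c *\<^sub>R b)) \<and> span B = V"
  using assms(3,4)
proof (induction "dim V" arbitrary: V rule: less_induct)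
  case less
  show ?case
  proof (cases "V = {0}")
    case True
    then show ?thesis by (intro exI[of _ "{}"]) auto
  next
    case False
    obtain x c where x: "x \<in> V" "norm x = 1" "f x = c *\<^sub>R x"
      using self_adjoint_eigenvector[OF f sa less.prems False] by metis
    have xx: "x \<bullet> x = 1" using x by (simp add: norm_eq_1)
    define U where "U = V \<inter> {y. orthogonal x y}"
    have U: "subspace U" unfolding U_def
      by (intro subspace_inter less.prems subspace_orthogonal_to_vector)
    have fU: "f ` U \<subseteq> U"
    proof (intro image_subsetI)
      fix y assume y: "y \<in> U"
      have "x \<bullet> f y = c * (x \<bullet> y)" using sa[of x y] x(3) by simp
      then show "f y \<in> U"
        using y less.prems(2) by (auto simp: U_def orthogonal_def)
    qed
    have "x \<notin> U" using xx by (simp add: U_def orthogonal_def)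
    then have "U \<subset> V" using x(1) unfolding U_def by blast
    then have "dim U < dim V"
      using U less.prems(1) by (intro dim_psubset) (simp add: span_eq_iff[THEN iffD2])
    from less.hyps[OF this U fU] obtain B where B: "pairwise orthogonal B"
      "\<And>b. b \<in> B \<Longrightarrow> norm b = 1 \<and> (\<exists>c. f b = c *\<^sub>R b)" "span B = U" by blast
    have BU: "B \<subseteq> U" using B(3) span_superset by blast
    have "span (insert x B) = V"
    proof
      show "span (insert x B) \<subseteq> V"
        using BU x(1) less.prems(1) by (intro span_minimal) (auto simp: U_def)
      show "V \<subseteq> span (insert x B)"
      proof
        fix v assume v: "v \<in> V"
        have "v - (x \<bullet> v) *\<^sub>R x \<in> U"
          using v x(1) less.prems(1)
          by (auto simp: U_def orthogonal_def inner_diff xx intro!: subspace_diff subspace_scale)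
        then show "v \<in> span (insert x B)"
          unfolding span_insert B(3) by blast
      qed
    qed
    moreover have "pairwise orthogonal (insert x B)"
      using B(1) BU by (auto simp: pairwise_insert U_def orthogonal_commute)
    ultimately show ?thesis
      using B(2) x(2,3) by (intro exI[of _ "insert x B"]) auto
  qed
qed

lemma transpose_inner: "(transpose A *v x) \<bullet> y = x \<bullet> (A *v y)" for A :: "real ^ 'n ^ 'm"
  by (simp add: dot_lmul_matrix)

lemma pos_def_inner: "pos_def A \<Longrightarrow> (A *v x) \<bullet> y = x \<bullet> (A *v y)"
  by (metis pos_def_def transpose_inner)

text \<open>In an orthonormal eigenbasis \<open>B\<close> the eigenvalue of \<open>b\<close> is \<open>w b = b \<bullet> A b\<close>, so \<open>R\<close> acts on \<open>b\<close>
  as multiplication by \<open>sqrt (w b)\<close>.\<close>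

lemma pos_def_square_root:
  fixes A :: "real ^ 'p ^ 'p"
  assumes A: "pos_def A"
  obtains R where "pos_def R" "R ** R = A"
proof -
  obtain B where B: "pairwise orthogonal B" and B1: "\<And>b. b \<in> B \<Longrightarrow> norm b = 1"
    and eig: "\<And>b. b \<in> B \<Longrightarrow> \<exists>c. A *v b = c *\<^sub>R b" and span: "span B = UNIV"
    using self_adjoint_eigenbasis[of "(*v) A" UNIV] pos_def_inner[OF A] by auto
  have fin: "finite B"
    using B B1 by (intro pairwise_orthogonal_imp_finite)
  define w where "w b = b \<bullet> (A *v b)" for b
  have Ab: "A *v b = w b *\<^sub>R b" if "b \<in> B" for b
    using eig[OF that] B1[OF that] by (auto simp: w_def norm_eq_1)
  have w: "0 < w b" if "b \<in> B" for b
  proof -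
    have "b \<noteq> 0" using B1[OF that] by auto
    then show ?thesis using A by (simp add: w_def pos_def_def)
  qed
  have expand: "x = (\<Sum>b\<in>B. (x \<bullet> b) *\<^sub>R b)" for x
    using orthonormal_basis_expand[OF B B1 _ fin, of x] span by simp
  define r where "r x = (\<Sum>b\<in>B. (sqrt (w b) * (x \<bullet> b)) *\<^sub>R b)" for x
  have r: "linear r"
    unfolding r_def by (rule linearI) (simp_all add: inner_add algebra_simps sum.distrib scaleR_sum_right)
  have r_inner: "r x \<bullet> y = (\<Sum>b\<in>B. sqrt (w b) * (x \<bullet> b) * (y \<bullet> b))" for x y
    unfolding r_def inner_sum_left by (simp add: inner_commute)
  have r_eig: "r b = sqrt (w b) *\<^sub>R b" if "b \<in> B" for b
  proof -
    have "r b = (\<Sum>a\<in>B. if a = b then sqrt (w b) *\<^sub>R b else 0)"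
      unfolding r_def using B B1[OF that] that
      by (intro sum.cong) (auto simp: pairwise_def orthogonal_def norm_eq_1)
    then show ?thesis using fin that by simp
  qed
  define R where "R = matrix r"
  have R: "R *v x = r x" for x using r by (simp add: R_def)
  have "transpose R = R"
  proof -
    have r_sa: "r x \<bullet> y = x \<bullet> r y" for x y
      unfolding inner_commute[of x "r y"] r_inner by (simp add: mult_ac)
    have "(transpose R *v x) \<bullet> y = (R *v x) \<bullet> y" for x y
      unfolding transpose_inner R r_sa ..
    then show ?thesis
      by (metis matrix_eq vector_eq_rdot)
  qed
  moreover have "0 < x \<bullet> (R *v x)" if "x \<noteq> 0" for x
  proof -
    have "\<exists>b\<in>B. x \<bullet> b \<noteq> 0"
    proof (rule ccontr)
      assume "\<not> ?thesis"
      then have "(\<Sum>b\<in>B. (x \<bullet> b) *\<^sub>R b) = 0" by simp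
      with expand[of x] that show False by simp
    qed
    then obtain b where b: "b \<in> B" "x \<bullet> b \<noteq> 0" by blast
    have "0 < (\<Sum>b\<in>B. sqrt (w b) * ((x \<bullet> b) * (x \<bullet> b)))"
      using w b by (intro sum_pos2[OF fin b(1)]) (auto simp: less_imp_le zero_less_mult_iff)
    then show ?thesis
      unfolding R inner_commute[of x "r x"] r_inner by (simp add: mult.assoc)
  qed
  moreover have "R ** R = A"
  proof (intro matrix_eq[THEN iffD2] allI)
    fix x
    have "(R ** R) *v b = A *v b" if "b \<in> B" for b
      using that w[OF that]
      by (simp add: R r_eig Ab linear_cmul[OF r] less_imp_le flip: matrix_vector_mul_assoc)
    then show "(R ** R) *v x = A *v x"
      using span by (intro linear_eq_on[of "(*v) (R ** R)" "(*v) A" x B]) auto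
  qed
  ultimately show thesis using that by (auto simp: pos_def_def)
qed

section \<open>The trace inequality\<close>

lemma pos_def_inverse:
  fixes A :: "real ^ 'p ^ 'p"
  assumes A: "pos_def A"
  shows "A ** matrix_inv A = mat 1" "matrix_inv A ** A = mat 1" "pos_def (matrix_inv A)"
proof -
  have "x = 0" if "A *v x = 0" for x
    using A that unfolding pos_def_def by (metis inner_zero_right less_irrefl)
  then have "\<exists>B. B ** A = mat 1"
    unfolding matrix_left_invertible_ker by blast
  then have "\<exists>B. A ** B = mat 1 \<and> B ** A = mat 1"
    using matrix_left_right_inverse by blast
  then have "A ** matrix_inv A = mat 1 \<and> matrix_inv A ** A = mat 1"
    unfolding matrix_inv_def by (rule someI_ex)
  then show right: "A ** matrix_inv A = mat 1" and left: "matrix_inv A ** A = mat 1"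
    by auto
  have "transpose (matrix_inv A) ** A = mat 1"
    using arg_cong[OF right, of transpose] A by (simp add: matrix_transpose_mul pos_def_def)
  then have "transpose (matrix_inv A) = matrix_inv A"
    by (metis right matrix_mul_assoc matrix_mul_lid matrix_mul_rid)
  moreover have "0 < x \<bullet> (matrix_inv A *v x)" if "x \<noteq> 0" for x
  proof -
    define y where "y = matrix_inv A *v x"
    have "A *v y = x" by (simp add: y_def matrix_vector_mul_assoc right)
    then show ?thesis using A that unfolding pos_def_def
      by (metis inner_commute matrix_vector_mult_0_right y_def)
  qed
  ultimately show "pos_def (matrix_inv A)" by (simp add: pos_def_def)
qed

lemma pos_def_scaleR: "pos_def A \<Longrightarrow> 0 < c \<Longrightarrow> pos_def (c *\<^sub>R A)"
  by (simp add: pos_def_def transpose_scalar flip: scaleR_matrix_vector_assoc)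

lemma matrix_diff_ldistrib: "A ** (B - C) = A ** B - A ** C" for A :: "real ^ 'n ^ 'm"
  by (simp add: matrix_matrix_mult_def vec_eq_iff right_diff_distrib sum_subtractf)

lemma matrix_diff_rdistrib: "(A - B) ** C = A ** C - B ** C" for A :: "real ^ 'n ^ 'm"
  by (simp add: matrix_matrix_mult_def vec_eq_iff left_diff_distrib sum_subtractf)

lemma trace_scaleR: "trace (c *\<^sub>R A) = c * trace A" for A :: "real ^ 'p ^ 'p"
  by (simp add: trace_def sum_distrib_left)

lemma pos_def_trace_pos:
  fixes A :: "real ^ 'p ^ 'p"
  assumes "pos_def A"
  shows "0 < trace A"
proof -
  have "0 < A $ i $ i" for i
  proof -
    have "0 < axis i 1 \<bullet> (A *v axis i 1)"
      using assms by (auto simp: pos_def_def)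
    then show ?thesis
      by (simp add: inner_axis' matrix_vector_mult_basis column_def)
  qed
  then show ?thesis by (simp add: trace_def sum_pos)
qed

lemma trace_congruence:
  fixes B :: "real ^ 'p ^ 'p" and C :: "real ^ 'n ^ 'p"
  shows "trace (transpose C ** B ** C) = (\<Sum>j\<in>UNIV. column j C \<bullet> (B *v column j C))"
proof -
  have "(transpose C ** (B ** C)) $ j $ j = column j C \<bullet> (B *v column j C)" for j
    by (simp add: matrix_matrix_mult_def transpose_def column_def inner_vec_def matrix_vector_mult_def)
  then show ?thesis by (simp add: trace_def flip: matrix_mul_assoc)
qed

text \<open>Complete the square: with \<open>C = R - t A\<close> and \<open>t = trace R\<close>, the product \<open>C A\<^sup>-\<^sup>1 C\<close> expands to
  \<open>R A\<^sup>-\<^sup>1 R - 2 t R + t\<^sup>2 A\<close>, whose trace is the gap between the two sides. As \<open>A\<^sup>-\<^sup>1\<close> is positive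
  definite, the trace is a sum of nonnegative terms over the columns of \<open>C\<close>, and it vanishes only
  if every column does.\<close>

lemma trace_inverse_square_ge:
  fixes R A :: "real ^ 'p ^ 'p"
  assumes R: "pos_def R" and A: "A \<in> unit_trace_pd"
  shows "(trace R)\<^sup>2 \<le> trace (matrix_inv A ** (R ** R))"
    and "trace (matrix_inv A ** (R ** R)) = (trace R)\<^sup>2 \<Longrightarrow> R = trace R *\<^sub>R A"
proof -
  define t where "t = trace R"
  define C where "C = R - t *\<^sub>R A"
  define I where "I = matrix_inv A"
  have pA: "pos_def A" and tA: "trace A = 1" using A by (auto simp: unit_trace_pd_def)
  have inv: "A ** I = mat 1" "I ** A = mat 1" "pos_def I"
    unfolding I_def using pos_def_inverse[OF pA] by auto
  have tC: "transpose C = C"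
    using R pA by (simp add: C_def pos_def_def transpose_def vec_eq_iff)
  have "C ** I ** C = R ** I ** R - t *\<^sub>R R - t *\<^sub>R R + t\<^sup>2 *\<^sub>R A"
  proof -
    have CI: "C ** I = R ** I - t *\<^sub>R mat 1"
      by (simp add: C_def matrix_diff_rdistrib inv flip: scalar_matrix_assoc)
    have "C ** I ** C = C ** I ** R - t *\<^sub>R (C ** (I ** A))"
      by (subst (2) C_def)
        (simp add: matrix_diff_ldistrib matrix_scalar_ac matrix_mul_assoc flip: scalar_matrix_assoc)
    then show ?thesis
      by (simp add: inv CI matrix_diff_rdistrib C_def power2_eq_square algebra_simps
          flip: scalar_matrix_assoc)
  qed
  then have "trace (transpose C ** I ** C) = trace (R ** I ** R) - t\<^sup>2"
    by (simp only: tC trace_add trace_sub trace_scaleR tA flip: t_def)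
      (simp add: power2_eq_square)
  also have "trace (R ** I ** R) = trace (I ** (R ** R))"
    by (metis trace_mul_sym matrix_mul_assoc)
  finally have eq: "trace (I ** (R ** R)) - t\<^sup>2 = (\<Sum>j\<in>UNIV. column j C \<bullet> (I *v column j C))"
    by (simp add: trace_congruence)
  have nonneg: "0 \<le> x \<bullet> (I *v x)" for x
    using inv(3) by (cases "x = 0") (auto simp: pos_def_def less_imp_le)
  have "0 \<le> (\<Sum>j\<in>UNIV. column j C \<bullet> (I *v column j C))"
    by (intro sum_nonneg nonneg)
  with eq show "(trace R)\<^sup>2 \<le> trace (matrix_inv A ** (R ** R))"
    by (simp add: I_def t_def)
  assume "trace (matrix_inv A ** (R ** R)) = (trace R)\<^sup>2"
  then have "(\<Sum>j\<in>UNIV. column j C \<bullet> (I *v column j C)) = 0"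
    using eq by (simp add: I_def t_def)
  then have "column j C \<bullet> (I *v column j C) = 0" for j
    using nonneg by (simp add: sum_nonneg_eq_0_iff)
  then have "column j C = 0" for j
    using inv(3) unfolding pos_def_def by (metis less_irrefl)
  then have "C = 0" by (simp add: column_def vec_eq_iff)
  then show "R = trace R *\<^sub>R A" by (simp add: C_def t_def)
qed

lemma trace_inverse_square_normalized:
  fixes R :: "real ^ 'p ^ 'p"
  assumes R: "pos_def R"
  defines "P \<equiv> (1 / trace R) *\<^sub>R R"
  shows "P \<in> unit_trace_pd" "trace (matrix_inv P ** (R ** R)) = (trace R)\<^sup>2"
proof -
  have t: "0 < trace R" by (rule pos_def_trace_pos[OF R])
  show P: "P \<in> unit_trace_pd"
    using t by (simp add: P_def unit_trace_pd_def trace_scaleR pos_def_scaleR[OF R])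
  have "matrix_inv P ** (R ** R) = trace R *\<^sub>R (matrix_inv P ** P ** R)"
    using t by (simp add: P_def matrix_mul_assoc matrix_scalar_ac flip: scalar_matrix_assoc)
  also have "\<dots> = trace R *\<^sub>R R"
    using P by (simp add: pos_def_inverse unit_trace_pd_def)
  finally show "trace (matrix_inv P ** (R ** R)) = (trace R)\<^sup>2"
    by (simp add: trace_scaleR power2_eq_square)
qed

lemma is_arg_min_trace_iff:
  fixes R A :: "real ^ 'p ^ 'p"
  assumes R: "pos_def R"
  shows "is_arg_min (\<lambda>A. trace (matrix_inv A ** (R ** R))) (\<lambda>A. A \<in> unit_trace_pd) A
    \<longleftrightarrow> A = (1 / trace R) *\<^sub>R R" (is "is_arg_min ?f _ A \<longleftrightarrow> A = ?P")
proof -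
  note P = trace_inverse_square_normalized[OF R]
  note ge = trace_inverse_square_ge[OF R]
  show ?thesis
  proof
    assume A: "is_arg_min ?f (\<lambda>A. A \<in> unit_trace_pd) A"
    then have mem: "A \<in> unit_trace_pd" and "?f A \<le> ?f ?P"
      using P(1) unfolding is_arg_min_def by (auto simp: not_less)
    then have "?f A = (trace R)\<^sup>2" using ge(1)[OF mem] P(2) by simp
    then have "?P = (1 / trace R) *\<^sub>R (trace R *\<^sub>R A)" using ge(2)[OF mem] by simp
    then show "A = ?P" using pos_def_trace_pos[OF R] by simp
  next
    assume "A = ?P"
    then show "is_arg_min ?f (\<lambda>A. A \<in> unit_trace_pd) A"
      using P ge(1) by (simp add: is_arg_min_def not_less)
  qed
qed

text \<open>Both \<open>R\<close> and \<open>S\<close> pose the same minimization problem. Comparing minimizers shows that they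
  agree after normalization of the trace; comparing minimum values shows that their traces agree.\<close>

lemma pos_def_square_root_unique:
  fixes R S :: "real ^ 'p ^ 'p"
  assumes R: "pos_def R" and S: "pos_def S" and eq: "R ** R = S ** S"
  shows "R = S"
proof -
  have *: "(1 / trace R) *\<^sub>R R = (1 / trace S) *\<^sub>R S"
    using is_arg_min_trace_iff[OF R] is_arg_min_trace_iff[OF S] eq by metis
  then have "(trace R)\<^sup>2 = (trace S)\<^sup>2"
    using trace_inverse_square_normalized(2)[OF R] trace_inverse_square_normalized(2)[OF S] eq
    by metis
  then have "trace R = trace S"
    using pos_def_trace_pos[OF R] pos_def_trace_pos[OF S] by (simp add: power2_eq_iff)
  with * show ?thesis using pos_def_trace_pos[OF S] by simp
qed

section \<open>Polar factors\<close>

lemma orthonormal_rows_iff: "orthonormal_rows Q \<longleftrightarrow> Q ** transpose Q = mat 1"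
  by (auto simp: orthonormal_rows_def matrix_mult_transpose_dot_row mat_def vec_eq_iff)

lemma orthonormal_rows_norm:
  fixes Q :: "real ^ 'n ^ 'p"
  assumes "orthonormal_rows Q"
  shows "norm Q = sqrt (real CARD('p))"
  using assms by (simp add: orthonormal_rows_def norm_eq_sqrt_inner inner_vec_def[of Q] row_def vec_lambda_eta)

lemma left_polar_square: "left_polar X S Q \<Longrightarrow> S ** S = X ** transpose X"
  unfolding left_polar_def orthonormal_rows_iff pos_def_def
  by (metis matrix_mul_assoc matrix_mul_rid matrix_transpose_mul)

lemma left_polar_square_root:
  assumes R: "pos_def R" and sq: "R ** R = X ** transpose X"
  shows "left_polar X R (matrix_inv R ** X)"
proof -
  note inv = pos_def_inverse[OF R]
  have "(matrix_inv R ** X) ** transpose (matrix_inv R ** X)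
      = matrix_inv R ** (X ** transpose X) ** matrix_inv R"
    using inv(3) by (simp add: matrix_transpose_mul matrix_mul_assoc pos_def_def)
  also have "\<dots> = mat 1"
    unfolding sq[symmetric] by (simp add: matrix_mul_assoc inv)
  finally show ?thesis
    using R by (simp add: left_polar_def orthonormal_rows_iff matrix_mul_assoc inv)
qed

lemma pos_def_gram:
  fixes X :: "real ^ 'n ^ 'p"
  assumes "rank X = CARD('p)"
  shows "pos_def (X ** transpose X)"
proof -
  have inj: "inj ((*v) (transpose X))"
    using assms by (simp add: full_rank_injective[symmetric] rank_transpose)
  have "0 < x \<bullet> ((X ** transpose X) *v x)" if "x \<noteq> 0" for x
  proof -
    have "transpose X *v x \<noteq> 0"
      using inj that by (metis injD matrix_vector_mult_0_right)
    then show ?thesis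
      by (metis inner_gt_zero_iff matrix_vector_mul_assoc transpose_inner)
  qed
  then show ?thesis by (simp add: pos_def_def matrix_transpose_mul)
qed

theorem theorem9:
  fixes X W :: "real ^ 'n ^ 'p" and P :: "real ^ 'p ^ 'p" and l :: real
  assumes "CARD('p) \<le> CARD('n)"
    and "rank X = CARD('p)"
    and "P = arg_min (\<lambda>A. trace (matrix_inv A ** (X ** transpose X))) (\<lambda>A. A \<in> unit_trace_pd)"
    and "l = norm (matrix_inv P ** X)"
    and "W = (1 / l) *\<^sub>R (matrix_inv P ** X)"
  shows "(\<exists>!A. is_arg_min (\<lambda>A. trace (matrix_inv A ** (X ** transpose X))) (\<lambda>A. A \<in> unit_trace_pd) A)
    \<and> P \<in> unit_trace_pd
    \<and> 0 < l
    \<and> X = l *\<^sub>R (P ** W)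
    \<and> (\<forall>S Q. left_polar X S Q \<longleftrightarrow>
          S = (l / sqrt (real CARD('p))) *\<^sub>R P \<and> Q = sqrt (real CARD('p)) *\<^sub>R W)"
proof -
  let ?min = "is_arg_min (\<lambda>A. trace (matrix_inv A ** (X ** transpose X))) (\<lambda>A. A \<in> unit_trace_pd)"
  obtain R where R: "pos_def R" and sq: "R ** R = X ** transpose X"
    using pos_def_square_root[OF pos_def_gram[OF assms(2)]] .
  define t where "t = trace R"
  define Q0 where "Q0 = matrix_inv R ** X"
  define s where "s = sqrt (real CARD('p))"
  have t: "0 < t" unfolding t_def by (rule pos_def_trace_pos[OF R])
  have s: "0 < s" by (simp add: s_def)
  have min_iff: "?min A \<longleftrightarrow> A = (1 / t) *\<^sub>R R" for A
    using is_arg_min_trace_iff[OF R] by (simp add: sq t_def)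
  have "?min P"
    unfolding assms(3) arg_min_def using min_iff by (metis someI)
  then have P: "P = (1 / t) *\<^sub>R R" and P_mem: "P \<in> unit_trace_pd"
    using min_iff by (auto simp: is_arg_min_def)
  have R_eq: "R = t *\<^sub>R P" using t P by simp
  have polar: "left_polar X R Q0"
    unfolding Q0_def by (rule left_polar_square_root[OF R sq])
  \<comment> \<open>Substituting \<open>X = R Q0 = t P Q0\<close> avoids an inversion formula for multiples of \<open>R\<close>.\<close>
  have "matrix_inv P ** X = t *\<^sub>R (matrix_inv P ** P ** Q0)"
    using polar R_eq unfolding left_polar_def
    by (metis matrix_mul_assoc matrix_scalar_ac scalar_matrix_assoc)
  also have "\<dots> = t *\<^sub>R Q0"
    using P_mem by (simp add: pos_def_inverse unit_trace_pd_def)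
  finally have PX: "matrix_inv P ** X = t *\<^sub>R Q0" .
  have l: "l = t * s"
    using t polar unfolding assms(4) PX by (simp add: orthonormal_rows_norm left_polar_def s_def)
  have W: "W = (1 / s) *\<^sub>R Q0"
    unfolding assms(5) PX using t by (simp add: l)
  have "left_polar X S Q \<longleftrightarrow> S = R \<and> Q = Q0" for S Q
  proof
    assume SQ: "left_polar X S Q"
    then have S: "pos_def S" and X: "X = S ** Q" by (auto simp: left_polar_def)
    have "S = R"
      using left_polar_square[OF SQ] sq by (intro pos_def_square_root_unique[OF S R]) simp
    moreover have "Q = Q0"
      using pos_def_inverse(2)[OF R] X \<open>S = R\<close> by (simp add: Q0_def matrix_mul_assoc)
    ultimately show "S = R \<and> Q = Q0" ..
  qed (use polar in simp)
  moreover have "(l / s) *\<^sub>R P = R" "s *\<^sub>R W = Q0"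
    using s by (simp_all add: l W R_eq)
  moreover have "X = l *\<^sub>R (P ** W)"
    using polar s t by (simp add: l W R_eq left_polar_def matrix_scalar_ac flip: scalar_matrix_assoc)
  moreover have "0 < l" using l s t by simp
  ultimately show ?thesis
    using min_iff P_mem by (auto simp: s_def)
qed

end
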